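(* Let $\mathcal{F}$ be a real Hilbert space of functions on $\mathcal{X}$, let $\mathcal{H}$ be the reproducing kernel Hilbert space of a bounded positive semidefinite kernel $k$ on $\mathcal{X}$, and let $\mu:\mathcal{F}\to\mathcal{H}$, $\mu(f)=\int_{\mathcal{X}}k(x,\cdot)f(x)\,d\nu(x)$, be the kernel mean embedding, a bounded linear operator. Let $F:\mathcal{H}\to\mathbb{R}$ be a generator and let $\Phi:\mathcal{F}\to\mathbb{R}$ be given by $\Phi(f)=F(\mu(f))$, with $\mathcal{A}=\operatorname{int}(\operatorname{dom}\Phi)$. Then for all $f,g\in\mathcal{A}$, $$d_\Phi(f,g)=d_F\big(\mu(f),\mu(g)\big).$$ Moreover, if $\mu$ is injective on $\mathcal{A}$, then $\Phi=F\circ\mu$ is a generator on $\mathcal{F}$.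
   Context: A function $\Psi:\mathcal{E}\to(-\infty,\infty]$ on a real Hilbert space $\mathcal{E}$ is called a generator if it is proper, lower semicontinuous, strictly convex, and Fréchet differentiable on $\operatorname{int}(\operatorname{dom}\Psi)\neq\emptyset$. For a function $\Psi$ on $\mathcal{E}$ that is Fréchet differentiable on $\operatorname{int}(\operatorname{dom}\Psi)$, with gradient $\nabla\Psi$ (Riesz representer of the Fréchet derivative), put $d_\Psi(f,g)=\Psi(f)-\Psi(g)-\langle\nabla\Psi(g),f-g\rangle_{\mathcal{E}}$ for $f,g\in\operatorname{int}(\operatorname{dom}\Psi)$. Here $\mathcal{X}\subseteq\mathbb{R}^d$ carries a measure $\nu$, and it is a standing assumption that the kernel mean embedding $\mu$ is a well-defined bounded linear operator from $\mathcal{F}$ to $\mathcal{H}$ (so that its adjoint $\mu^\ast:\mathcal{H}\to\mathcal{F}$ is defined). Since $F$ is real-valued, $\operatorname{dom}\Phi=\mathcal{F}$. *)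

theory Defs
  imports "HOL-Analysis.Analysis"
begin

definition eff_dom :: "('e \<Rightarrow> ereal) \<Rightarrow> 'e set" where
  "eff_dom \<Psi> = {x. \<Psi> x < \<infinity>}"

definition proper :: "('e \<Rightarrow> ereal) \<Rightarrow> bool" where
  "proper \<Psi> \<longleftrightarrow> (\<forall>x. \<Psi> x \<noteq> - \<infinity>) \<and> eff_dom \<Psi> \<noteq> {}"

definition lower_semicontinuous :: "('e::topological_space \<Rightarrow> ereal) \<Rightarrow> bool" where
  "lower_semicontinuous \<Psi> \<longleftrightarrow> (\<forall>x. \<Psi> x \<le> Liminf (at x) \<Psi>)"

definition strictly_convex :: "('e::real_vector \<Rightarrow> ereal) \<Rightarrow> bool" where
  "strictly_convex \<Psi> \<longleftrightarrow>
     (\<forall>x\<in>eff_dom \<Psi>. \<forall>y\<in>eff_dom \<Psi>. \<forall>t. x \<noteq> y \<longrightarrow> 0 < t \<longrightarrow> t < 1 \<longrightarrow>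
        \<Psi> ((1 - t) *\<^sub>R x + t *\<^sub>R y) < ereal (1 - t) * \<Psi> x + ereal t * \<Psi> y)"

text \<open>
  Differentiability is that of the real-valued function obtained with \<open>real_of_ereal\<close>. At an
  interior point of the effective domain this is unaffected by the junk value
  \<open>real_of_ereal \<infinity> = 0\<close>, since a proper function is finite on a neighbourhood of that point.
\<close>

definition generator :: "('e::{real_inner, banach} \<Rightarrow> ereal) \<Rightarrow> bool" where
  "generator \<Psi> \<longleftrightarrow>
     proper \<Psi> \<and> lower_semicontinuous \<Psi> \<and> strictly_convex \<Psi> \<and>
     interior (eff_dom \<Psi>) \<noteq> {} \<and>
     (\<forall>x\<in>interior (eff_dom \<Psi>). (\<lambda>z. real_of_ereal (\<Psi> z)) differentiable (at x))"

text \<open>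
  \<open>grad\<close> and \<open>bregman\<close> are meaningful only at points of \<open>interior (eff_dom \<Psi>)\<close> where \<open>\<Psi>\<close> is
  differentiable. There, \<open>GDERIV\<close> says that the Frechet derivative is \<open>\<lambda>h. inner h D\<close>, so \<open>grad\<close>
  is the Riesz representer of the derivative.
\<close>

definition grad :: "('e::{real_inner, banach} \<Rightarrow> ereal) \<Rightarrow> 'e \<Rightarrow> 'e" where
  "grad \<Psi> x = (THE D. GDERIV (\<lambda>z. real_of_ereal (\<Psi> z)) x :> D)"

definition bregman :: "('e::{real_inner, banach} \<Rightarrow> ereal) \<Rightarrow> 'e \<Rightarrow> 'e \<Rightarrow> real" where
  "bregman \<Psi> f g =
     real_of_ereal (\<Psi> f) - real_of_ereal (\<Psi> g) - inner (grad \<Psi> g) (f - g)"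

text \<open>
  A Hilbert space of functions on \<open>X\<close> is a Hilbert space type \<open>'e\<close> with an evaluation map
  \<open>ev :: 'e \<Rightarrow> 'x \<Rightarrow> real\<close>: the function represented by \<open>f\<close> is the restriction of \<open>ev f\<close> to \<open>X\<close>.
  Vector space operations are pointwise, and an element is determined by its function on \<open>X\<close>.
  A space of classes modulo null sets, such as \<open>L\<^sup>2\<close>, is covered by taking for \<open>ev\<close> a linear
  choice of representatives (which exists, by means of a Hamel basis).
\<close>

definition function_space_on ::
    "'x set \<Rightarrow> ('e::real_vector \<Rightarrow> 'x \<Rightarrow> real) \<Rightarrow> bool" where
  "function_space_on X ev \<longleftrightarrow>
     (\<forall>x\<in>X. linear (\<lambda>f. ev f x)) \<and>
     (\<forall>f g. (\<forall>x\<in>X. ev f x = ev g x) \<longrightarrow> f = g)"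

definition psd_kernel_on :: "'x set \<Rightarrow> ('x \<Rightarrow> 'x \<Rightarrow> real) \<Rightarrow> bool" where
  "psd_kernel_on X k \<longleftrightarrow>
     (\<forall>x\<in>X. \<forall>y\<in>X. k x y = k y x) \<and>
     (\<forall>n (x :: nat \<Rightarrow> 'x) (c :: nat \<Rightarrow> real). (\<forall>i<n. x i \<in> X) \<longrightarrow>
        0 \<le> (\<Sum>i<n. \<Sum>j<n. c i * c j * k (x i) (x j)))"

definition bounded_kernel_on :: "'x set \<Rightarrow> ('x \<Rightarrow> 'x \<Rightarrow> real) \<Rightarrow> bool" where
  "bounded_kernel_on X k \<longleftrightarrow> (\<exists>B. \<forall>x\<in>X. \<forall>y\<in>X. \<bar>k x y\<bar> \<le> B)"

definition rkhs_on ::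
    "'x set \<Rightarrow> ('x \<Rightarrow> 'x \<Rightarrow> real) \<Rightarrow> ('h::{real_inner, banach} \<Rightarrow> 'x \<Rightarrow> real) \<Rightarrow> bool" where
  "rkhs_on X k ev \<longleftrightarrow>
     function_space_on X ev \<and>
     (\<forall>x\<in>X. \<exists>\<kappa>. (\<forall>y\<in>X. ev \<kappa> y = k x y) \<and> (\<forall>h. ev h x = inner h \<kappa>))"

text \<open>
  The function-valued integral \<open>\<integral> k(x,\<cdot>) f(x) d\<nu>(x)\<close> is taken pointwise, which determines the
  element \<open>\<mu> f\<close> of the RKHS. (The Bochner integral of the library needs a second countable range.
  When a Bochner or weak integral exists it satisfies this condition, because evaluation at a
  point is a bounded functional on an RKHS.)
\<close>

definition kernel_mean_embedding ::
    "'x measure \<Rightarrow> ('x \<Rightarrow> 'x \<Rightarrow> real) \<Rightarrow> ('f \<Rightarrow> 'x \<Rightarrow> real) \<Rightarrow> ('h \<Rightarrow> 'x \<Rightarrow> real) \<Rightarrow>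
      ('f \<Rightarrow> 'h) \<Rightarrow> bool" where
  "kernel_mean_embedding \<nu> k evF evH \<mu> \<longleftrightarrow>
     (\<forall>f. \<forall>y\<in>space \<nu>.
        integrable \<nu> (\<lambda>x. k x y * evF f x) \<and>
        evH (\<mu> f) y = (\<integral>x. k x y * evF f x \<partial>\<nu>))"

end

theory Submission
  imports Defs
begin

text \<open>
  Since \<open>F\<close> is finite everywhere, it is Frechet differentiable on the whole space, hence so is
  \<open>\<Phi> = F \<circ> \<mu>\<close>, and the chain rule gives
  \<open>\<langle>\<nabla>\<Phi>(g), h\<rangle> = \<langle>\<nabla>F(\<mu> g), \<mu> h\<rangle>\<close>; with \<open>h = f - g\<close> this is the identity of the
  divergences. Strict convexity is the only generator property that needs injectivity of \<open>\<mu>\<close>.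
  The gradients exist by the Riesz representation theorem: a bounded functional \<open>\<phi>\<close> is represented
  by the minimiser of \<open>\<langle>x, x\<rangle> - 2 \<phi>(x)\<close>.
\<close>

lemma riesz_representation:
  fixes \<phi> :: "'e::{real_inner, banach} \<Rightarrow> real"
  assumes "bounded_linear \<phi>"
  obtains D where "\<And>h. \<phi> h = inner h D"
proof -
  interpret \<phi>: bounded_linear \<phi> by fact
  define J where "J x = inner x x - 2 * \<phi> x" for x
  obtain K where K: "\<And>x. norm (\<phi> x) \<le> norm x * K"
    using \<phi>.bounded by blast
  \<comment> \<open>Completing the square: with \<open>K\<close> bounding \<open>\<phi>\<close>,
    \<open>J x\<close> is at least \<open>(norm x - K)\<^sup>2 - K\<^sup>2\<close>.\<close>
  have J_ge: "- (K\<^sup>2) \<le> J x" for x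
  proof -
    have "0 \<le> (norm x - K)\<^sup>2" by simp
    moreover have "\<phi> x \<le> norm x * K" using K[of x] by simp
    ultimately show ?thesis
      unfolding J_def by (simp add: dot_square_norm power2_diff)
  qed
  have bdd: "bdd_below (range J)"
    using J_ge by (rule bdd_belowI2)
  define m where "m = Inf (range J)"
  have m_le: "m \<le> J x" for x
    unfolding m_def using bdd by (rule cInf_lower[rotated]) simp
  have "\<exists>x. J x < m + 1 / real (Suc n)" for n
    using cInf_lessD[of "range J" "m + 1 / real (Suc n)"] by (auto simp: m_def)
  then obtain u where u: "\<And>n. J (u n) < m + 1 / real (Suc n)"
    by metis
  \<comment> \<open>The linear part of \<open>J\<close> cancels, which leaves the parallelogram law.
    As \<open>J\<close> is at least \<open>m\<close> at the midpoint, two points with values below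
    \<open>m + e\<^sup>2 / 4\<close> are closer than \<open>e\<close>; hence minimising sequences
    are Cauchy.\<close>
  have parallelogram: "(norm (x - y))\<^sup>2 = 2 * (J x + J y - 2 * J ((1/2) *\<^sub>R (x + y)))" for x y
    unfolding J_def power2_norm_eq_inner
    by (simp add: \<phi>.scaleR \<phi>.add inner_simps inner_commute algebra_simps)
  have "Cauchy u"
  proof (rule metric_CauchyI)
    fix e :: real assume "0 < e"
    then obtain N where N: "1 / real (Suc N) < e\<^sup>2 / 4"
      using reals_Archimedean[of "e\<^sup>2 / 4"] by (auto simp: inverse_eq_divide)
    have u_N: "J (u n) < m + e\<^sup>2 / 4" if "N \<le> n" for n
    proof -
      have "1 / real (Suc n) \<le> 1 / real (Suc N)"
        using that by (intro divide_left_mono) auto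
      with u[of n] N show ?thesis by linarith
    qed
    have "dist (u i) (u j) < e" if "N \<le> i" "N \<le> j" for i j
    proof -
      have "(norm (u i - u j))\<^sup>2 < e\<^sup>2"
        unfolding parallelogram using u_N[OF that(1)] u_N[OF that(2)]
          m_le[of "(1/2) *\<^sub>R (u i + u j)"] by argo
      then show ?thesis
        using \<open>0 < e\<close> by (simp add: dist_norm power2_less_imp_less)
    qed
    then show "\<exists>M. \<forall>i\<ge>M. \<forall>j\<ge>M. dist (u i) (u j) < e" by blast
  qed
  then obtain D where D: "u \<longlonglongrightarrow> D"
    using Cauchy_convergent_iff convergentD by blast
  have "(\<lambda>n. J (u n)) \<longlonglongrightarrow> J D"
    unfolding J_def by (intro tendsto_intros \<phi>.tendsto D)
  moreover have "(\<lambda>n. m + 1 / real (Suc n)) \<longlonglongrightarrow> m + 0"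
    by (intro tendsto_intros LIMSEQ_Suc lim_1_over_n)
  ultimately have "J D \<le> m"
    using u by (intro LIMSEQ_le[where X = "\<lambda>n. J (u n)"]) (auto intro: less_imp_le)
  then have min: "J D \<le> J x" for x
    using m_le[of x] by linarith
  have "\<phi> h = inner h D" for h
  proof (cases "h = 0")
    case True
    then show ?thesis by (simp add: \<phi>.zero)
  next
    case False
    define a where "a = inner h D - \<phi> h"
    have pos: "0 < inner h h" using False by simp
    have expand: "J (D + t *\<^sub>R h) = J D + 2 * t * a + t\<^sup>2 * inner h h" for t
      unfolding J_def a_def
      by (simp add: \<phi>.scaleR \<phi>.add inner_simps inner_commute power2_eq_square algebra_simps)
    \<comment> \<open>The chosen \<open>t = - a / inner h h\<close> minimises the quadratic in
      \<open>expand\<close>. There \<open>J\<close> changes by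
      \<open>- (a\<^sup>2 / inner h h)\<close>, so minimality of \<open>D\<close> forces
      \<open>a = 0\<close>.\<close>
    have "0 \<le> 2 * (- a / inner h h) * a + (- a / inner h h)\<^sup>2 * inner h h"
      using min[of "D + (- a / inner h h) *\<^sub>R h"] unfolding expand by linarith
    also have "\<dots> = - (a\<^sup>2 / inner h h)"
      using pos by (simp add: power2_eq_square field_simps)
    finally have "a\<^sup>2 \<le> 0"
      using pos by (simp add: divide_le_0_iff)
    then show ?thesis by (simp add: a_def)
  qed
  then show ?thesis by (rule that)
qed

text \<open>Riesz representation and uniqueness of the derivative make the definite description in
  \<open>grad\<close> well-defined. Afterwards gradients are handled only through the derivatives
  they represent.\<close>

lemma inner_grad:
  fixes f :: "'e::{real_inner, banach} \<Rightarrow> real"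
  assumes f': "(f has_derivative f') (at x)"
  shows "inner h (grad (\<lambda>z. ereal (f z)) x) = f' h"
proof -
  obtain D where D: "\<And>h. f' h = inner h D"
    using riesz_representation[OF has_derivative_bounded_linear[OF f']] by blast
  have "grad (\<lambda>z. ereal (f z)) x = D"
    unfolding grad_def real_of_ereal.simps
  proof (rule the_equality)
    show "GDERIV f x :> D"
      using f' unfolding gderiv_def D .
    fix E assume "GDERIV f x :> E"
    then have "f' = (\<lambda>h. inner h E)"
      unfolding gderiv_def using f' by (intro has_derivative_unique)
    \<comment> \<open>Testing both representers on their difference gives
      \<open>inner (E - D) (E - D) = 0\<close>.\<close>
    then have "inner (E - D) E = inner (E - D) D"
      using D by metis
    then show "E = D"
      by (metis inner_diff_right inner_eq_zero_iff right_minus_eq)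
  qed
  then show ?thesis by (simp add: D)
qed

lemma lower_semicontinuous_ereal:
  assumes "\<And>x. isCont f x"
  shows "lower_semicontinuous (\<lambda>x. ereal (f x))"
  unfolding lower_semicontinuous_def
proof
  fix x
  show "ereal (f x) \<le> Liminf (at x) (\<lambda>x. ereal (f x))"
  \<comment> \<open>At an isolated point, as in the zero space, the punctured filter is trivial and
    its \<open>Liminf\<close> is \<open>\<infinity>\<close>.\<close>
  proof (cases "at x = bot")
    case False
    have "((\<lambda>x. ereal (f x)) \<longlongrightarrow> ereal (f x)) (at x)"
      using assms by (simp add: isCont_def)
    from lim_imp_Liminf[OF False this] show ?thesis by simp
  qed (simp add: Liminf_bot top_ereal_def)
qed

lemma eff_dom_ereal [simp]: "eff_dom (\<lambda>x. ereal (f x)) = UNIV"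
  by (simp add: eff_dom_def)

lemma strictly_convex_ereal:
  "strictly_convex (\<lambda>x. ereal (f x)) \<longleftrightarrow>
    (\<forall>x y t. x \<noteq> y \<longrightarrow> 0 < t \<longrightarrow> t < 1 \<longrightarrow>
      f ((1 - t) *\<^sub>R x + t *\<^sub>R y) < (1 - t) * f x + t * f y)"
  by (simp add: strictly_convex_def)

text \<open>A finite-valued function has the whole space as effective domain, and differentiability
  everywhere yields continuity, hence lower semicontinuity.\<close>

lemma generator_ereal:
  fixes f :: "'e::{real_inner, banach} \<Rightarrow> real"
  shows "generator (\<lambda>x. ereal (f x)) \<longleftrightarrow>
    strictly_convex (\<lambda>x. ereal (f x)) \<and> (\<forall>x. f differentiable (at x))"
  by (auto simp: generator_def proper_def
      intro!: lower_semicontinuous_ereal differentiable_imp_continuous_within)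

lemma bregman_comp:
  fixes \<mu> :: "'f::{real_inner, banach} \<Rightarrow> 'h::{real_inner, banach}" and F :: "'h \<Rightarrow> real"
  assumes \<mu>: "bounded_linear \<mu>" and F: "F differentiable (at (\<mu> g))"
  shows "bregman (\<lambda>f. ereal (F (\<mu> f))) f g = bregman (\<lambda>h. ereal (F h)) (\<mu> f) (\<mu> g)"
proof -
  obtain F' where F': "(F has_derivative F') (at (\<mu> g))"
    using F by (auto simp: differentiable_def)
  have "((\<lambda>f. F (\<mu> f)) has_derivative (\<lambda>h. F' (\<mu> h))) (at g)"
    using bounded_linear_imp_has_derivative[OF \<mu>] F' by (rule has_derivative_compose)
  then show ?thesis
    by (simp add: bregman_def inner_commute[of "grad _ _"] inner_grad[OF F'] inner_grad
        bounded_linear.linear[OF \<mu>] linear_diff)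
qed

lemma generator_comp:
  fixes \<mu> :: "'f::{real_inner, banach} \<Rightarrow> 'h::{real_inner, banach}" and F :: "'h \<Rightarrow> real"
  assumes \<mu>: "bounded_linear \<mu>" and inj: "inj \<mu>" and F: "generator (\<lambda>h. ereal (F h))"
  shows "generator (\<lambda>f. ereal (F (\<mu> f)))"
  unfolding generator_ereal
proof
  interpret \<mu>: bounded_linear \<mu> by fact
  show "strictly_convex (\<lambda>f. ereal (F (\<mu> f)))"
    using F inj
    \<comment> \<open>Linearity carries convex combinations to convex combinations, and injectivity
      keeps distinct points distinct, so the strict inequality for \<open>F\<close> applies to the
      images.\<close>
    by (simp add: generator_ereal strictly_convex_ereal \<mu>.add \<mu>.scaleR inj_eq)
  show "\<forall>f. (\<lambda>f. F (\<mu> f)) differentiable (at f)"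
    using F differentiable_compose[of F \<mu>] \<mu>
    by (auto simp: generator_ereal intro: bounded_linear_imp_differentiable)
qed

theorem proposition14:
  fixes X :: "(real ^ 'd) set"
    and \<nu> :: "(real ^ 'd) measure"
    and k :: "real ^ 'd \<Rightarrow> real ^ 'd \<Rightarrow> real"
    and evF :: "'f::{real_inner, banach} \<Rightarrow> real ^ 'd \<Rightarrow> real"
    and evH :: "'h::{real_inner, banach} \<Rightarrow> real ^ 'd \<Rightarrow> real"
    and \<mu> :: "'f \<Rightarrow> 'h"
    and F :: "'h \<Rightarrow> real"
    and \<Phi> :: "'f \<Rightarrow> real"
    and A :: "'f set"
  assumes "space \<nu> = X"
    and "function_space_on X evF"
    and "psd_kernel_on X k"
    and "bounded_kernel_on X k"
    and "rkhs_on X k evH"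
    and "kernel_mean_embedding \<nu> k evF evH \<mu>"
    and "bounded_linear \<mu>"
    and "generator (\<lambda>h. ereal (F h))"
    and "\<And>f. \<Phi> f = F (\<mu> f)"
    and "A = interior (eff_dom (\<lambda>f. ereal (\<Phi> f)))"
  shows "(\<forall>f\<in>A. \<forall>g\<in>A.
            bregman (\<lambda>f. ereal (\<Phi> f)) f g = bregman (\<lambda>h. ereal (F h)) (\<mu> f) (\<mu> g)) \<and>
         (inj_on \<mu> A \<longrightarrow> generator (\<lambda>f. ereal (\<Phi> f)))"
proof -
  have \<Phi>: "\<Phi> = (\<lambda>f. F (\<mu> f))"
    by (rule ext) fact
  \<comment> \<open>Thus \<open>inj_on \<mu> A\<close> becomes injectivity on the whole space, as
    \<open>generator_comp\<close> requires.\<close>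
  have "A = UNIV"
    using assms(10) by simp
  then show ?thesis
    using bregman_comp[OF assms(7)] generator_comp[OF assms(7) _ assms(8)] assms(8)
    by (simp add: \<Phi> generator_ereal)
qed

end
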